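(* Let $V$ be a finite-dimensional vector space over a field $F$, let $Q\colon V\to F$ be a quadratic form whose polar form $B$ is non-degenerate, let $Q^\uparrow\colon F\times V^*\to F$, $Q^\uparrow(a_0,a^* )=Q\bigl(D^{-1}(a^* )\bigr)$, and let $c\in F^\times$. Then $$\mathrm{AO}(V,Q)^{\beta}=\mathrm{O}'(F\times V^*,cQ^\uparrow).$$
   Context: $F$ is an arbitrary (commutative) field, $F^\times=F\setminus\{0\}$. $V^*$ is the dual of $V$ with canonical pairing $\langle\cdot,\cdot\rangle$. For a linear map $\eta$, $\eta^{\mathrm T}\colon a^*\mapsto a^*\circ\eta$ is its transpose. For a quadratic form $Q$ on $V$: polar form $B(x,y)=Q(x+y)-Q(x)-Q(y)$; induced linear map $D\colon V\to V^*$, $D(x)=B(x,\cdot)$; radical $V^\perp=\{x\in V\mid B(x,y)=0\ \forall y\in V\}$; $B$ is non-degenerate if $V^\perp=\{0\}$ (equivalently $D$ is bijective). $\mathrm{O}(V,Q)=\{\varphi\in\mathrm{GL}(V)\mid Q\circ\varphi=Q\}$ is the orthogonal group; the weak orthogonal group $\mathrm{O}'(V,Q)$ is the subgroup of those $\varphi\in\mathrm{O}(V,Q)$ fixing every vector of $V^\perp$. The same notions apply to quadratic forms on $F\times V^*$. $\mathrm{AGL}(V)$ is the group of all affinities $\gamma\colon V\to V$, $\gamma(x)=t+\gamma_+(x)$ with (unique) $\gamma_+\in\mathrm{GL}(V)$, $t\in V$. The motion group $\mathrm{AO}(V,Q)$ consists of all $\gamma\in\mathrm{AGL}(V)$ with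 $\gamma_+\in\mathrm{O}(V,Q)$ (and arbitrary $t$). $\beta\colon\mathrm{AGL}(V)\to\mathrm{GL}(F\times V^* )$, $\gamma\mapsto\gamma^\beta$, is the faithful linear representation given by $$\gamma^\beta(a_0,a^* )=\Bigl(a_0-\bigl\langle(\gamma_+^{\mathrm T})^{-1}(a^* ),t\bigr\rangle,\ (\gamma_+^{\mathrm T})^{-1}(a^* )\Bigr).$$ For a subgroup $G\leq\mathrm{AGL}(V)$, $G^\beta$ denotes its image under $\beta$. *)

theory Defs
  imports
    "HOL.Vector_Spaces"
    "HOL-Library.FuncSet"
    "HOL-Library.Function_Algebras"
    "HOL-Library.Product_Plus"
begin

text \<open>
  The vector space \<open>V\<close> is a whole type with an explicit scalar multiplication. Its dual is only a
  subspace of the functions \<open>'v \<Rightarrow> 'f\<close>. To cover both \<open>V\<close> and \<open>F \<times> V*\<close>, the notions below are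
  relative to a subspace \<open>W\<close>. Maps on \<open>W\<close> are extensional (\<open>undefined\<close> outside \<open>W\<close>), so equality
  of such maps is equality on \<open>W\<close>; for \<open>W = UNIV\<close> this is no restriction.
\<close>

definition linear_on ::
  "('f \<Rightarrow> 'a \<Rightarrow> 'a) \<Rightarrow> ('f \<Rightarrow> 'b \<Rightarrow> 'b) \<Rightarrow> 'a set \<Rightarrow> ('a::ab_group_add \<Rightarrow> 'b::ab_group_add) \<Rightarrow> bool"
  where "linear_on s1 s2 W f \<longleftrightarrow>
    (\<forall>x\<in>W. \<forall>y\<in>W. f (x + y) = f x + f y) \<and> (\<forall>r. \<forall>x\<in>W. f (s1 r x) = s2 r (f x))"

definition GL :: "('f \<Rightarrow> 'a \<Rightarrow> 'a) \<Rightarrow> 'a set \<Rightarrow> ('a::ab_group_add \<Rightarrow> 'a) set"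
  where "GL s W = {\<phi> \<in> extensional W. bij_betw \<phi> W W \<and> linear_on s s W \<phi>}"


subsection \<open>Quadratic forms and their orthogonal groups\<close>

definition polar_form :: "('a \<Rightarrow> 'f) \<Rightarrow> 'a::ab_group_add \<Rightarrow> 'a \<Rightarrow> 'f::field"
  where "polar_form Q x y = Q (x + y) - Q x - Q y"

definition quadratic_form ::
  "('f \<Rightarrow> 'a \<Rightarrow> 'a) \<Rightarrow> 'a set \<Rightarrow> ('a::ab_group_add \<Rightarrow> 'f::field) \<Rightarrow> bool"
  where "quadratic_form s W Q \<longleftrightarrow>
    (\<forall>r. \<forall>x\<in>W. Q (s r x) = r\<^sup>2 * Q x) \<and>
    (\<forall>x\<in>W. linear_on s (*) W (\<lambda>y. polar_form Q x y)) \<and>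
    (\<forall>y\<in>W. linear_on s (*) W (\<lambda>x. polar_form Q x y))"

definition radical :: "'a set \<Rightarrow> ('a::ab_group_add \<Rightarrow> 'f::field) \<Rightarrow> 'a set"
  where "radical W Q = {x \<in> W. \<forall>y\<in>W. polar_form Q x y = 0}"

definition nondegenerate :: "'a set \<Rightarrow> ('a::ab_group_add \<Rightarrow> 'f::field) \<Rightarrow> bool"
  where "nondegenerate W Q \<longleftrightarrow> radical W Q = {0}"

definition orthogonal_group ::
  "('f \<Rightarrow> 'a \<Rightarrow> 'a) \<Rightarrow> 'a set \<Rightarrow> ('a::ab_group_add \<Rightarrow> 'f::field) \<Rightarrow> ('a \<Rightarrow> 'a) set"
  where "orthogonal_group s W Q = {\<phi> \<in> GL s W. \<forall>x\<in>W. Q (\<phi> x) = Q x}"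

definition weak_orthogonal_group ::
  "('f \<Rightarrow> 'a \<Rightarrow> 'a) \<Rightarrow> 'a set \<Rightarrow> ('a::ab_group_add \<Rightarrow> 'f::field) \<Rightarrow> ('a \<Rightarrow> 'a) set"
  where "weak_orthogonal_group s W Q = {\<phi> \<in> orthogonal_group s W Q. \<forall>x\<in>radical W Q. \<phi> x = x}"


subsection \<open>Affinities and motions\<close>

definition AGL :: "('f \<Rightarrow> 'v \<Rightarrow> 'v) \<Rightarrow> ('v::ab_group_add \<Rightarrow> 'v) set"
  where "AGL scale = {\<gamma>. \<exists>g\<in>GL scale UNIV. \<exists>t. \<forall>x. \<gamma> x = t + g x}"

definition linear_part :: "('f \<Rightarrow> 'v \<Rightarrow> 'v) \<Rightarrow> ('v \<Rightarrow> 'v) \<Rightarrow> 'v::ab_group_add \<Rightarrow> 'v"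
  where "linear_part scale \<gamma> = (THE g. g \<in> GL scale UNIV \<and> (\<exists>t. \<forall>x. \<gamma> x = t + g x))"

definition translation_part :: "('f \<Rightarrow> 'v \<Rightarrow> 'v) \<Rightarrow> ('v \<Rightarrow> 'v) \<Rightarrow> 'v::ab_group_add"
  where "translation_part scale \<gamma> = (THE t. \<exists>g\<in>GL scale UNIV. \<forall>x. \<gamma> x = t + g x)"

lemma GL_zero: "g 0 = 0" if "g \<in> GL scale UNIV"
proof -
  have "g (0 + 0) = g 0 + g 0"
    using that unfolding GL_def linear_on_def by blast
  then show ?thesis by simp
qed

lemma translation_part_eq:
  assumes "g \<in> GL scale UNIV" and "\<And>x. \<gamma> x = t + g x"
  shows "translation_part scale \<gamma> = t"
  unfolding translation_part_def
proof (rule the_equality)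
  show "\<exists>g\<in>GL scale UNIV. \<forall>x. \<gamma> x = t + g x" using assms by blast
  fix u assume "\<exists>h\<in>GL scale UNIV. \<forall>x. \<gamma> x = u + h x"
  then obtain h where h: "h \<in> GL scale UNIV" "\<And>x. \<gamma> x = u + h x" by blast
  show "u = t"
    using h(2)[of 0] assms(2)[of 0] GL_zero[OF h(1)] GL_zero[OF assms(1)] by simp
qed

lemma linear_part_eq:
  assumes "g \<in> GL scale UNIV" and "\<And>x. \<gamma> x = t + g x"
  shows "linear_part scale \<gamma> = g"
  unfolding linear_part_def
proof (rule the_equality)
  show "g \<in> GL scale UNIV \<and> (\<exists>t. \<forall>x. \<gamma> x = t + g x)" using assms by blast
  fix h assume h: "h \<in> GL scale UNIV \<and> (\<exists>u. \<forall>x. \<gamma> x = u + h x)"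
  then obtain u where u: "\<And>x. \<gamma> x = u + h x" by blast
  have "h \<in> GL scale UNIV" using h by blast
  then have "u = t"
    using u[of 0] assms(2)[of 0] GL_zero[of h scale] GL_zero[OF assms(1)] by simp
  then show "h = g" using u assms(2) by (intro ext) (metis add_left_cancel)
qed

definition AO :: "('f \<Rightarrow> 'v \<Rightarrow> 'v) \<Rightarrow> ('v::ab_group_add \<Rightarrow> 'f::field) \<Rightarrow> ('v \<Rightarrow> 'v) set"
  where "AO scale Q = {\<gamma> \<in> AGL scale. linear_part scale \<gamma> \<in> orthogonal_group scale UNIV Q}"


subsection \<open>The dual space and the linear representation\<close>

definition dual :: "('f \<Rightarrow> 'v \<Rightarrow> 'v) \<Rightarrow> ('v::ab_group_add \<Rightarrow> 'f::field) set"
  where "dual scale = {a. Vector_Spaces.linear scale (*) a}"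

definition transpose_map :: "('v \<Rightarrow> 'v) \<Rightarrow> ('v \<Rightarrow> 'f) \<Rightarrow> 'v \<Rightarrow> 'f"
  where "transpose_map \<eta> a = a \<circ> \<eta>"

text \<open>Addition on \<open>F \<times> V*\<close> is the componentwise and pointwise one from the type class instances.\<close>

abbreviation F_dual :: "('f \<Rightarrow> 'v \<Rightarrow> 'v) \<Rightarrow> ('f::field \<times> ('v::ab_group_add \<Rightarrow> 'f)) set"
  where "F_dual scale \<equiv> UNIV \<times> dual scale"

definition F_dual_scale :: "'f::field \<Rightarrow> 'f \<times> ('v \<Rightarrow> 'f) \<Rightarrow> 'f \<times> ('v \<Rightarrow> 'f)"
  where "F_dual_scale r = (\<lambda>(a0, a). (r * a0, \<lambda>x. r * a x))"

definition beta ::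
  "('f \<Rightarrow> 'v \<Rightarrow> 'v) \<Rightarrow> ('v::ab_group_add \<Rightarrow> 'v) \<Rightarrow> 'f::field \<times> ('v \<Rightarrow> 'f) \<Rightarrow> 'f \<times> ('v \<Rightarrow> 'f)"
  where "beta scale \<gamma> = restrict
    (\<lambda>(a0, a).
      let b = inv_into (dual scale) (transpose_map (linear_part scale \<gamma>)) a
      in (a0 - b (translation_part scale \<gamma>), b))
    (F_dual scale)"

text \<open>
  If the polar form is non-degenerate and \<open>V\<close> finite-dimensional, \<open>polar_form Q\<close> (the map \<open>D\<close>) is a
  bijection from \<open>V\<close> onto the dual, so \<open>inv (polar_form Q)\<close> is its inverse on the dual; values of
  \<open>Q_up\<close> outside \<open>F \<times> V*\<close> are irrelevant.
\<close>

definition Q_up :: "('v::ab_group_add \<Rightarrow> 'f::field) \<Rightarrow> 'f \<times> ('v \<Rightarrow> 'f) \<Rightarrow> 'f"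
  where "Q_up Q = (\<lambda>(a0, a). Q (inv (polar_form Q) a))"

end

theory Submission
  imports Defs
begin

text \<open>
  Non-degeneracy and finite dimension make \<open>D = polar_form Q\<close> an isomorphism of \<open>V\<close> onto \<open>V*\<close>
  (\<open>polar_form_surj\<close>). Under it \<open>Q_up\<close> is \<open>Q\<close> with a one-dimensional radical \<open>F \<times> 0\<close> added
  (\<open>radical_scaled_Q_up\<close>), and \<open>g \<in> O(V,Q)\<close> corresponds to the inverse transpose
  \<open>a \<mapsto> a \<circ> g\<^sup>-\<^sup>1\<close>, because \<open>B(gx, y) = B(x, g\<^sup>-\<^sup>1 y)\<close> (\<open>polar_inv_isometry\<close>). Hence the image of a motion
  preserves \<open>c Q_up\<close>, and it visibly fixes \<open>F \<times> 0\<close>.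

  Conversely, an isometry \<open>\<phi>\<close> that fixes \<open>F \<times> 0\<close> pointwise has the block form
  \<open>(a\<^sub>0, a) \<mapsto> (a\<^sub>0 + l a, h a)\<close>, and \<open>g = D\<^sup>-\<^sup>1 \<circ> h \<circ> D\<close> preserves \<open>Q\<close>. What remains is to write the
  linear form \<open>l\<close> as \<open>a \<mapsto> - h a t\<close> for a vector \<open>t\<close>; on substituting \<open>a = D y\<close> this asks for
  \<open>B(g y, t) = - l (D y)\<close> for all \<open>y\<close>, and surjectivity of \<open>D\<close> provides \<open>t\<close>. Then \<open>\<phi>\<close> is the image of
  the motion \<open>x \<mapsto> t + g x\<close>. Scaling by \<open>c \<noteq> 0\<close> changes neither the isometries nor the radical.
\<close>

section \<open>Linear maps, the dual and the representation of affinities\<close>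

lemma polar_form_commute: "polar_form Q x y = polar_form Q y x"
  by (simp add: polar_form_def add.commute)

lemma linear_on_comp:
  assumes "linear_on s1 s2 UNIV f" and "linear_on s2 s3 UNIV g"
  shows "linear_on s1 s3 UNIV (g \<circ> f)"
  using assms by (simp add: linear_on_def)

lemma linear_on_inv:
  assumes "linear_on s s UNIV g" and "bij g"
  shows "linear_on s s UNIV (inv g)"
  unfolding linear_on_def
proof (intro conjI ballI allI)
  note lin = assms(1)[unfolded linear_on_def, simplified]
  have g_inv: "g (inv g z) = z" for z
    using assms(2) by (simp add: bij_is_surj surj_f_inv_f)
  fix x y
  have "g (inv g x + inv g y) = x + y" using lin g_inv by simp
  then show "inv g (x + y) = inv g x + inv g y"
    using assms(2) by (metis bij_inv_eq_iff)
next
  note lin = assms(1)[unfolded linear_on_def, simplified]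
  fix r x
  have "g (s r (inv g x)) = s r x"
    using lin assms(2) by (simp add: bij_is_surj surj_f_inv_f)
  then show "inv g (s r x) = s r (inv g x)"
    using assms(2) by (metis bij_inv_eq_iff)
qed

lemma GL_UNIV_iff: "g \<in> GL s UNIV \<longleftrightarrow> bij g \<and> linear_on s s UNIV g"
  by (simp add: GL_def)

lemma (in vector_space) mem_dual_iff: "a \<in> dual scale \<longleftrightarrow> linear_on scale (*) UNIV a"
proof -
  have "vector_space ((*) :: 'a \<Rightarrow> 'a \<Rightarrow> 'a)"
    by unfold_locales (simp_all add: algebra_simps)
  then show ?thesis
    using vector_space_axioms
    by (auto simp: dual_def linear_on_def Vector_Spaces.linear_iff)
qed

lemma (in vector_space) inv_transpose_map:
  assumes g: "g \<in> GL scale UNIV" and a: "a \<in> dual scale"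
  shows "inv_into (dual scale) (transpose_map g) a = a \<circ> inv g"
proof (rule inv_into_f_eq)
  have bij: "bij g" and lin: "linear_on scale scale UNIV g"
    using g by (simp_all add: GL_UNIV_iff)
  show "inj_on (transpose_map g) (dual scale)"
    using bij by (auto simp: inj_on_def transpose_map_def fun_eq_iff) (metis bij_pointE)
  show "a \<circ> inv g \<in> dual scale"
    using linear_on_comp[OF linear_on_inv[OF lin bij]] a by (simp add: mem_dual_iff)
  show "transpose_map g (a \<circ> inv g) = a"
    using bij by (simp add: transpose_map_def fun_eq_iff bij_is_inj)
qed

lemma (in vector_space) beta_apply:
  assumes g: "g \<in> GL scale UNIV" and \<gamma>: "\<And>x. \<gamma> x = t + g x" and a: "a \<in> dual scale"
  shows "beta scale \<gamma> (a0, a) = (a0 - a (inv g t), a \<circ> inv g)"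
  using inv_transpose_map[OF g a] a
  by (simp add: beta_def linear_part_eq[OF g \<gamma>] translation_part_eq[OF g \<gamma>] Let_def)

lemma (in vector_space) beta_in_GL:
  assumes g: "g \<in> GL scale UNIV" and \<gamma>: "\<And>x. \<gamma> x = t + g x"
  shows "beta scale \<gamma> \<in> GL F_dual_scale (F_dual scale)"
proof -
  have bij: "bij g" and lin: "linear_on scale scale UNIV g"
    using g by (simp_all add: GL_UNIV_iff)
  have comp_g: "a \<circ> g \<in> dual scale" if "a \<in> dual scale" for a :: "'b \<Rightarrow> 'a"
    using linear_on_comp[OF lin] that by (simp add: mem_dual_iff)
  have comp_inv: "a \<circ> inv g \<in> dual scale" if "a \<in> dual scale" for a :: "'b \<Rightarrow> 'a"
    using linear_on_comp[OF linear_on_inv[OF lin bij]] that by (simp add: mem_dual_iff)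
  have add: "a + b \<in> dual scale" if "a \<in> dual scale" "b \<in> dual scale" for a b :: "'b \<Rightarrow> 'a"
    using that by (simp add: mem_dual_iff linear_on_def algebra_simps)
  have mult: "(\<lambda>x. r * a x) \<in> dual scale" if "a \<in> dual scale" for r and a :: "'b \<Rightarrow> 'a"
    using that by (simp add: mem_dual_iff linear_on_def algebra_simps)
  have bij_beta: "bij_betw (beta scale \<gamma>) (F_dual scale) (F_dual scale)"
    by (rule bij_betw_byWitness[where f' = "\<lambda>(a0, a). (a0 + a t, a \<circ> g)"])
       (use bij in \<open>auto simp: beta_apply[OF g \<gamma>] comp_g comp_inv comp_assoc bij_is_inj
          bij_is_surj surj_f_inv_f surj_iff[THEN iffD1]\<close>)
  have "linear_on F_dual_scale F_dual_scale (F_dual scale) (beta scale \<gamma>)"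
    by (auto simp: linear_on_def F_dual_scale_def beta_apply[OF g \<gamma>] add mult fun_eq_iff
        algebra_simps)
  moreover have "beta scale \<gamma> \<in> extensional (F_dual scale)"
    by (simp add: beta_def)
  ultimately show ?thesis using bij_beta by (simp add: GL_def)
qed

section \<open>The isomorphism from a space onto its dual given by the polar form\<close>

locale nondegenerate_quadratic_space = finite_dimensional_vector_space scale Basis
  for scale :: "'f::field \<Rightarrow> 'v::ab_group_add \<Rightarrow> 'v" and Basis :: "'v set" +
  fixes Q :: "'v \<Rightarrow> 'f"
  assumes quadratic: "quadratic_form scale UNIV Q"
    and nondeg: "nondegenerate UNIV Q"
begin

abbreviation "D \<equiv> polar_form Q"
abbreviation "J \<equiv> inv (polar_form Q)"

lemma polar_linear_left: "linear_on scale (*) UNIV (\<lambda>x. D x y)"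
  and polar_linear_right: "linear_on scale (*) UNIV (D x)"
  using quadratic by (simp_all add: quadratic_form_def)

lemma polar_add_left: "D (x + y) z = D x z + D y z"
  and polar_scale_left: "D (scale r x) z = r * D x z"
  using polar_linear_left[of z] by (simp_all add: linear_on_def)

lemma polar_in_dual: "D x \<in> dual scale"
  using polar_linear_right by (simp add: mem_dual_iff)

lemma polar_zero_left: "D 0 = 0"
  using polar_scale_left[of 0 0] by (simp add: fun_eq_iff)

lemma polar_eq_zero_imp: "(\<And>y. D x y = 0) \<Longrightarrow> x = 0"
  using nondeg by (auto simp: nondegenerate_def radical_def)

lemma inj_polar_form: "inj D"
proof (rule injI)
  fix x y assume "D x = D y"
  then have "D (x - y) z = 0" for z
    using polar_add_left[of "x - y" y z] by simp
  then show "x = y" using polar_eq_zero_imp[of "x - y"] by simp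
qed

lemma linear_iff_linear_on: "Vector_Spaces.linear scale scale f \<longleftrightarrow> linear_on scale scale UNIV f"
  using vector_space_axioms by (auto simp: Vector_Spaces.linear_iff linear_on_def)

lemma dual_eqI:
  assumes "a \<in> dual scale" and "a' \<in> dual scale" and "\<And>b. b \<in> Basis \<Longrightarrow> a b = a' b"
  shows "a = a'"
proof
  interpret dual_pair: vector_space_pair scale "(*) :: 'f \<Rightarrow> 'f \<Rightarrow> 'f"
    using assms(1) by (auto simp: dual_def vector_space_pair_def Vector_Spaces.linear_iff)
  fix x
  show "a x = a' x"
    by (rule dual_pair.linear_eq_on[of a a' x Basis])
       (use assms span_Basis in \<open>auto simp: dual_def\<close>)
qed

text \<open>
  Reading off the values on a basis identifies the dual with \<open>V\<close>. This turns \<open>D\<close> into an injective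
  endomorphism of \<open>V\<close>, which finite dimension makes surjective.
\<close>

lemma polar_form_surj:
  assumes a: "a \<in> dual scale"
  obtains x where "D x = a"
proof -
  define T where "T x = (\<Sum>b\<in>Basis. scale (D x b) b)" for x
  have coeffs: "f b = f' b"
    if "(\<Sum>b\<in>Basis. scale (f b) b) = (\<Sum>b\<in>Basis. scale (f' b) b)" and "b \<in> Basis" for f f' b
  proof -
    have "(\<Sum>b\<in>Basis. scale (f b - f' b) b) = 0"
      using that(1) by (simp add: scale_left_diff_distrib sum_subtractf)
    then have "f b - f' b = 0"
      by (rule independentD[OF independent_Basis finite_Basis subset_refl
            _ that(2), where u = "\<lambda>b. f b - f' b"])
    then show ?thesis by simp
  qed
  have "Vector_Spaces.linear scale scale T"
    unfolding linear_iff_linear_on linear_on_def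
    by (simp add: T_def polar_add_left polar_scale_left scale_left_distrib sum.distrib
        scale_sum_right)
  moreover have "inj T"
  proof (rule injI)
    fix x y assume "T x = T y"
    then have "D x b = D y b" if "b \<in> Basis" for b
      using coeffs[of "D x" "D y"] that by (simp add: T_def)
    then have "D x = D y" by (intro dual_eqI polar_in_dual)
    then show "x = y" using inj_polar_form by (simp add: inj_eq)
  qed
  ultimately have "surj T" by (rule linear_inj_imp_surj)
  then obtain x where "T x = (\<Sum>b\<in>Basis. scale (a b) b)" by (metis surjD)
  then have "D x b = a b" if "b \<in> Basis" for b
    using coeffs[of "D x" a] that by (simp add: T_def)
  then have "D x = a" by (intro dual_eqI polar_in_dual a)
  then show thesis by (rule that)
qed

lemma J_polar [simp]: "J (D x) = x"
  using inj_polar_form by simp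

lemma polar_J [simp]: "a \<in> dual scale \<Longrightarrow> D (J a) = a"
  by (metis polar_form_surj J_polar)

lemma J_add:
  assumes "a \<in> dual scale" "b \<in> dual scale"
  shows "J (a + b) = J a + J b"
proof -
  have "D (J a + J b) = a + b"
    using assms by (simp add: fun_eq_iff polar_add_left)
  then show ?thesis by (metis J_polar)
qed

lemma J_scale:
  assumes "a \<in> dual scale"
  shows "J (\<lambda>x. r * a x) = scale r (J a)"
proof -
  have "D (scale r (J a)) = (\<lambda>x. r * a x)"
    using assms by (simp add: fun_eq_iff polar_scale_left)
  then show ?thesis by (metis J_polar)
qed

section \<open>Isometries\<close>

lemma polar_isometry:
  assumes "linear_on scale scale UNIV g" and "\<And>x. Q (g x) = Q x"
  shows "D (g x) (g y) = D x y"
proof -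
  have "g x + g y = g (x + y)" using assms(1) by (simp add: linear_on_def)
  then show ?thesis by (simp add: polar_form_def assms(2))
qed

text \<open>
  Linear isometries are injective because they preserve the non-degenerate polar form; finite
  dimension then makes them invertible.
\<close>

lemma isometry_in_orthogonal_group:
  assumes lin: "linear_on scale scale UNIV g" and iso: "\<And>x. Q (g x) = Q x"
  shows "g \<in> orthogonal_group scale UNIV Q"
proof -
  have "inj g"
  proof (rule injI)
    fix x y assume "g x = g y"
    then have "D x z = D y z" for z
      using polar_isometry[OF assms, of x z] polar_isometry[OF assms, of y z] by simp
    then show "x = y" using inj_polar_form by (metis ext injD)
  qed
  moreover have "surj g"
    using linear_inj_imp_surj[of g] lin \<open>inj g\<close> by (simp add: linear_iff_linear_on)
  ultimately show ?thesis
    using assms by (simp add: orthogonal_group_def GL_UNIV_iff bij_def)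
qed

text \<open>
  Invariance \<open>B(gx, gz) = B(x, z)\<close> at \<open>z = g\<^sup>-\<^sup>1 y\<close> moves \<open>g\<close> to the other argument; so \<open>D\<close>
  intertwines \<open>g\<close> with its inverse transpose.
\<close>

lemma polar_inv_isometry:
  assumes g: "g \<in> orthogonal_group scale UNIV Q"
  shows "D x \<circ> inv g = D (g x)"
proof
  fix y
  have "bij g" "linear_on scale scale UNIV g" "\<And>x. Q (g x) = Q x"
    using g by (simp_all add: orthogonal_group_def GL_UNIV_iff)
  then show "(D x \<circ> inv g) y = D (g x) y"
    using polar_isometry[of g x "inv g y"] by (simp add: bij_is_surj surj_f_inv_f)
qed

section \<open>Motions as weak orthogonal maps\<close>

text \<open>
  The polar form of \<open>Q_up\<close> ignores the first coordinate and is non-degenerate in the second, being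
  transported from \<open>V\<close> by the isomorphism \<open>D\<close>.
\<close>

lemma radical_scaled_Q_up:
  assumes "c \<noteq> 0"
  shows "radical (F_dual scale) (\<lambda>w. c * Q_up Q w) = UNIV \<times> {0}"
proof -
  have polar: "polar_form (\<lambda>w. c * Q_up Q w) (a0, a) (b0, b) = c * D (J a) (J b)"
    if "a \<in> dual scale" "b \<in> dual scale" for a0 a b0 b
    using that by (simp add: polar_form_def Q_up_def J_add algebra_simps del: polar_J)
  have zero: "(0 :: 'v \<Rightarrow> 'f) \<in> dual scale"
    using polar_in_dual[of 0] by (simp add: polar_zero_left)
  have "a = 0" if a: "a \<in> dual scale" and rad: "\<And>b. b \<in> dual scale \<Longrightarrow> D (J a) (J b) = 0" for a
  proof -
    have "D (J a) y = 0" for y using rad[OF polar_in_dual[of y]] by simp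
    then show ?thesis using a by (simp add: fun_eq_iff)
  qed
  then show ?thesis
    using assms zero by (auto simp: radical_def polar)
qed

lemma beta_AO_in_weak_orthogonal:
  assumes "c \<noteq> 0" and "\<gamma> \<in> AO scale Q"
  shows "beta scale \<gamma> \<in> weak_orthogonal_group F_dual_scale (F_dual scale) (\<lambda>w. c * Q_up Q w)"
proof -
  obtain g t where g: "g \<in> GL scale UNIV" and \<gamma>: "\<And>x. \<gamma> x = t + g x"
    using assms(2) by (auto simp: AO_def AGL_def)
  have orth: "g \<in> orthogonal_group scale UNIV Q"
    using assms(2) linear_part_eq[OF g \<gamma>] by (simp add: AO_def)
  have "J (a \<circ> inv g) = g (J a)" if "a \<in> dual scale" for a
    using polar_inv_isometry[OF orth, of "J a"] that by simp
  moreover have "Q (g x) = Q x" for x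
    using orth by (simp add: orthogonal_group_def)
  ultimately have "Q_up Q (beta scale \<gamma> w) = Q_up Q w" if "w \<in> F_dual scale" for w
    using that by (auto simp: Q_up_def beta_apply[OF g \<gamma>])
  moreover have "beta scale \<gamma> (a0, 0) = (a0, 0)" for a0
    using polar_in_dual[of 0]
    by (simp add: beta_apply[OF g \<gamma>] polar_zero_left fun_eq_iff)
  ultimately show ?thesis
    using beta_in_GL[OF g \<gamma>]
    by (auto simp: weak_orthogonal_group_def orthogonal_group_def radical_scaled_Q_up[OF assms(1)])
qed

lemma weak_orthogonal_in_beta_AO:
  assumes "c \<noteq> 0"
    and \<phi>: "\<phi> \<in> weak_orthogonal_group F_dual_scale (F_dual scale) (\<lambda>w. c * Q_up Q w)"
  shows "\<phi> \<in> beta scale ` AO scale Q"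
proof -
  have bij: "bij_betw \<phi> (F_dual scale) (F_dual scale)"
    and ext: "\<phi> \<in> extensional (F_dual scale)"
    and lin: "linear_on F_dual_scale F_dual_scale (F_dual scale) \<phi>"
    and iso: "\<And>w. w \<in> F_dual scale \<Longrightarrow> Q_up Q (\<phi> w) = Q_up Q w"
    and fixed: "\<And>a0. \<phi> (a0, 0) = (a0, 0)"
    using \<phi> assms(1)
    by (auto simp: weak_orthogonal_group_def orthogonal_group_def GL_def
        radical_scaled_Q_up[OF assms(1)])
  define l where "l a = fst (\<phi> (0, a))" for a
  define h where "h a = snd (\<phi> (0, a))" for a
  have h_dual: "h a \<in> dual scale" if "a \<in> dual scale" for a
  proof -
    have "\<phi> (0, a) \<in> F_dual scale" using bij_betwE[OF bij] that by blast
    then show ?thesis by (simp add: h_def mem_Times_iff)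
  qed
  have zero: "(0 :: 'v \<Rightarrow> 'f) \<in> dual scale"
    using polar_in_dual[of 0] by (simp add: polar_zero_left)
  have \<phi>_add: "\<phi> (w + w') = \<phi> w + \<phi> w'" if "w \<in> F_dual scale" "w' \<in> F_dual scale" for w w'
    using lin that unfolding linear_on_def by blast
  have \<phi>_scale: "\<phi> (F_dual_scale r w) = F_dual_scale r (\<phi> w)" if "w \<in> F_dual scale" for r w
    using lin that unfolding linear_on_def by blast
  \<comment> \<open>Since \<open>\<phi>\<close> fixes \<open>F \<times> 0\<close>, its values on \<open>0 \<times> V*\<close> determine it.\<close>
  have block: "\<phi> (a0, a) = (a0 + l a, h a)" if "a \<in> dual scale" for a0 a
    using \<phi>_add[of "(a0, 0)" "(0, a)"] that zero fixed[of a0]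
    by (simp add: l_def h_def prod_eq_iff)
  have D_add: "D (x + y) = D x + D y" for x y
    by (simp add: fun_eq_iff polar_add_left)
  have D_scale: "D (scale r x) = (\<lambda>y. r * D x y)" for r x
    by (simp add: fun_eq_iff polar_scale_left)
  have lh_add: "l (D (x + y)) = l (D x) + l (D y)" "h (D (x + y)) = h (D x) + h (D y)" for x y
    using \<phi>_add[of "(0, D x)" "(0, D y)"] polar_in_dual by (simp_all add: l_def h_def D_add)
  have lh_scale: "l (D (scale r x)) = r * l (D x)" "h (D (scale r x)) = (\<lambda>y. r * h (D x) y)" for r x
    using \<phi>_scale[of "(0, D x)" r] polar_in_dual
    by (simp_all add: l_def h_def D_scale F_dual_scale_def case_prod_unfold)

  define g where "g x = J (h (D x))" for x
  have g_lin: "linear_on scale scale UNIV g"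
    by (simp add: linear_on_def g_def lh_add lh_scale J_add J_scale h_dual polar_in_dual)
  have "Q (g x) = Q x" for x
    using iso[of "(0, D x)"] block[of "D x" 0] polar_in_dual[of x] by (simp add: Q_up_def g_def)
  then have orth: "g \<in> orthogonal_group scale UNIV Q"
    by (rule isometry_in_orthogonal_group[OF g_lin])
  then have g: "g \<in> GL scale UNIV" by (simp add: orthogonal_group_def)
  then have bij_g: "bij g" by (simp add: GL_UNIV_iff)
  have h_inv: "a \<circ> inv g = h a" if "a \<in> dual scale" for a
    using polar_inv_isometry[OF orth, of "J a"] that h_dual by (simp add: g_def)

  \<comment> \<open>The translation vector is read off from \<open>l a = - h a t\<close> at \<open>a = D (g\<^sup>-\<^sup>1 x)\<close>,
    where \<open>h a = D x\<close> and \<open>D x t = D t x\<close>.\<close>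
  have "(\<lambda>x. - l (D (inv g x))) \<in> dual scale"
    using linear_on_inv[OF g_lin bij_g]
    by (simp add: mem_dual_iff linear_on_def lh_add lh_scale)
  then obtain t where t: "D t = (\<lambda>x. - l (D (inv g x)))" by (rule polar_form_surj)
  have l_eq: "l a = - h a t" if "a \<in> dual scale" for a
  proof -
    have "h a t = D (g (J a)) t" using that h_dual by (simp add: g_def)
    also have "\<dots> = D t (g (J a))" by (rule polar_form_commute)
    also have "\<dots> = - l a" using t bij_g that by (simp add: bij_is_inj)
    finally show ?thesis by simp
  qed

  define \<gamma> where "\<gamma> x = t + g x" for x
  have "\<gamma> \<in> AO scale Q"
    using g orth \<gamma>_def unfolding AO_def AGL_def mem_Collect_eq linear_part_eq[OF g \<gamma>_def]
    by blast
  moreover have "\<phi> = beta scale \<gamma>"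
  proof (rule extensionalityI[OF ext])
    show "beta scale \<gamma> \<in> extensional (F_dual scale)" by (simp add: beta_def)
    fix w assume "w \<in> F_dual scale"
    then obtain a0 a where w: "w = (a0, a)" and a: "a \<in> dual scale" by blast
    have "a (inv g t) = h a t"
      using fun_cong[OF h_inv[OF a], of t] by simp
    then show "\<phi> w = beta scale \<gamma> w"
      by (simp add: w block[OF a] beta_apply[OF g \<gamma>_def a] l_eq[OF a] h_inv[OF a])
  qed
  ultimately show ?thesis by blast
qed

end

theorem proposition5p2:
  fixes scale :: "'f::field \<Rightarrow> 'v::ab_group_add \<Rightarrow> 'v"
    and Basis :: "'v set"
    and Q :: "'v \<Rightarrow> 'f"
    and c :: 'f
  assumes "finite_dimensional_vector_space scale Basis"
    and "quadratic_form scale UNIV Q"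
    and "nondegenerate UNIV Q"
    and "c \<noteq> 0"
  shows "beta scale ` AO scale Q
       = weak_orthogonal_group F_dual_scale (F_dual scale) (\<lambda>w. c * Q_up Q w)"
proof -
  interpret nondegenerate_quadratic_space scale Basis Q
    using assms by (simp add: nondegenerate_quadratic_space_def
        nondegenerate_quadratic_space_axioms_def)
  show ?thesis
    using beta_AO_in_weak_orthogonal[OF assms(4)] weak_orthogonal_in_beta_AO[OF assms(4)] by blast
qed

end
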